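(* Let $n \geq 4$ be an integer and let $QD_{2^n} = \langle a, b : a^{2^{n-1}} = b^2 = 1, bab^{-1} = a^{2^{n-2}-1}\rangle$ be the quasidihedral group. Then the Laplacian spectrum of the non-commuting graph $\mathcal{A}_{QD_{2^n}}$ of $QD_{2^n}$ is $$\{0, (2^{n-1})^{2^{n-1}-3}, (2^n-4)^{2^{n-2}}, (2^n-2)^{2^{n-2}}\}.$$
   Context: For a finite non-abelian group $G$ with centre $Z(G)$, the non-commuting graph $\mathcal{A}_G$ is the simple undirected graph with vertex set $G \setminus Z(G)$ in which two vertices $x,y$ are adjacent if and only if $xy \neq yx$. The Laplacian matrix of a finite graph is $D - A$, with $D$ the degree matrix and $A$ the adjacency matrix. The Laplacian spectrum is the multiset of eigenvalues of the Laplacian matrix; $\{\dots,\alpha^{a},\dots\}$ means the eigenvalue $\alpha$ is listed with multiplicity $a$ (not a power; no exponent means once, exponent $0$ means the entry is absent, and if listed values coincide their multiplicities add). *)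

theory Defs
  imports
    "HOL-Algebra.Group"
    "Graph_Theory.Pair_Digraph"
    "Jordan_Normal_Form.Char_Poly"
begin

section \<open>Groups given by generators and relations\<close>

datatype 'g letter = Gen 'g | Inv 'g

primrec flip :: "'g letter \<Rightarrow> 'g letter" where
  "flip (Gen g) = Inv g"
| "flip (Inv g) = Gen g"

text \<open>A relation \<open>u = v\<close> is the pair \<open>(u, v)\<close>. Free cancellation is part of the congruence, so
  that the quotient of the monoid of words is the quotient of the free group by the normal closure
  of the elements \<open>u v\<^sup>-\<^sup>1\<close>.\<close>

inductive word_eq :: "('g letter list \<times> 'g letter list) set \<Rightarrow> 'g letter list \<Rightarrow> 'g letter list \<Rightarrow> bool"
  for R where
  rel: "(u, v) \<in> R \<Longrightarrow> word_eq R u v"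
| cancel: "word_eq R [x, flip x] []"
| refl: "word_eq R u u"
| sym: "word_eq R u v \<Longrightarrow> word_eq R v u"
| trans: "word_eq R u v \<Longrightarrow> word_eq R v w \<Longrightarrow> word_eq R u w"
| append: "word_eq R u v \<Longrightarrow> word_eq R u' v' \<Longrightarrow> word_eq R (u @ u') (v @ v')"

definition word_class :: "('g letter list \<times> 'g letter list) set \<Rightarrow> 'g letter list \<Rightarrow> 'g letter list set" where
  "word_class R u = {v. word_eq R u v}"

definition presented_group :: "('g letter list \<times> 'g letter list) set \<Rightarrow> 'g letter list set monoid" where
  "presented_group R =
    \<lparr> carrier = range (word_class R),
      monoid.mult = (\<lambda>X Y. \<Union>u\<in>X. \<Union>v\<in>Y. word_class R (u @ v)),
      one = word_class R [] \<rparr>"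

lemma word_class_eq_iff: "word_class R u = word_class R v \<longleftrightarrow> word_eq R u v"
  unfolding word_class_def by (blast intro: word_eq.intros)

lemma mult_word_class:
  "word_class R u \<otimes>\<^bsub>presented_group R\<^esub> word_class R v = word_class R (u @ v)"
proof -
  have *: "word_class R (x @ y) = word_class R (u @ v)"
    if "x \<in> word_class R u" "y \<in> word_class R v" for x y
    using that unfolding word_class_eq_iff by (auto simp: word_class_def intro: word_eq.intros)
  have "u \<in> word_class R u" "v \<in> word_class R v"
    by (auto simp: word_class_def intro: word_eq.refl)
  then have "(\<Union>x\<in>word_class R u. \<Union>y\<in>word_class R v. word_class R (x @ y)) = word_class R (u @ v)"
    using * by blast
  then show ?thesis
    by (simp add: presented_group_def)
qed

lemma word_eq_inverse: "word_eq R (map flip (rev u) @ u) []"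
proof (induction u)
  case Nil
  show ?case by (simp add: word_eq.refl)
next
  case (Cons x u)
  have "flip (flip x) = x"
    by (cases x) auto
  then have "word_eq R [flip x, x] []"
    using word_eq.cancel[of R "flip x"] by simp
  then have "word_eq R (map flip (rev u) @ [flip x, x] @ u) (map flip (rev u) @ [] @ u)"
    by (intro word_eq.append word_eq.refl)
  then show ?case
    using Cons word_eq.trans by fastforce
qed

lemma group_presented_group: "group (presented_group R)"
proof (rule groupI)
  let ?G = "presented_group R"
  have car: "carrier ?G = range (word_class R)" and one: "\<one>\<^bsub>?G\<^esub> = word_class R []"
    by (simp_all add: presented_group_def)
  show "\<one>\<^bsub>?G\<^esub> \<in> carrier ?G"
    by (simp add: car one)
  fix X assume X: "X \<in> carrier ?G"
  then obtain u where u: "X = word_class R u"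
    by (auto simp: car)
  show "\<one>\<^bsub>?G\<^esub> \<otimes>\<^bsub>?G\<^esub> X = X"
    by (simp add: u one mult_word_class)
  show "\<exists>Y\<in>carrier ?G. Y \<otimes>\<^bsub>?G\<^esub> X = \<one>\<^bsub>?G\<^esub>"
    using word_eq_inverse[of R u]
    by (intro bexI[of _ "word_class R (map flip (rev u))"])
       (auto simp: u one car mult_word_class word_class_eq_iff)
  fix Y assume Y: "Y \<in> carrier ?G"
  then obtain v where v: "Y = word_class R v"
    by (auto simp: car)
  show "X \<otimes>\<^bsub>?G\<^esub> Y \<in> carrier ?G"
    by (simp add: u v car mult_word_class)
  fix Z assume Z: "Z \<in> carrier ?G"
  then obtain w where w: "Z = word_class R w"
    by (auto simp: car)
  show "X \<otimes>\<^bsub>?G\<^esub> Y \<otimes>\<^bsub>?G\<^esub> Z = X \<otimes>\<^bsub>?G\<^esub> (Y \<otimes>\<^bsub>?G\<^esub> Z)"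
    by (simp add: u v w mult_word_class)
qed

primrec letter_val :: "('a, 'b) monoid_scheme \<Rightarrow> ('g \<Rightarrow> 'a) \<Rightarrow> 'g letter \<Rightarrow> 'a" where
  "letter_val H f (Gen g) = f g"
| "letter_val H f (Inv g) = inv\<^bsub>H\<^esub> f g"

primrec word_val :: "('a, 'b) monoid_scheme \<Rightarrow> ('g \<Rightarrow> 'a) \<Rightarrow> 'g letter list \<Rightarrow> 'a" where
  "word_val H f [] = \<one>\<^bsub>H\<^esub>"
| "word_val H f (x # w) = letter_val H f x \<otimes>\<^bsub>H\<^esub> word_val H f w"

lemma presented_group_universal:
  assumes "group H" and f: "\<And>g. f g \<in> carrier H"
    and rels: "\<And>u v. (u, v) \<in> R \<Longrightarrow> word_val H f u = word_val H f v"
  shows "\<exists>\<phi>\<in>hom (presented_group R) H. \<forall>g. \<phi> (word_class R [Gen g]) = f g"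
proof -
  interpret H: group H by fact
  have lval: "letter_val H f x \<in> carrier H" for x
    by (cases x) (auto simp: f)
  have val: "word_val H f w \<in> carrier H" for w
    by (induction w) (auto simp: lval)
  have append: "word_val H f (u @ v) = word_val H f u \<otimes>\<^bsub>H\<^esub> word_val H f v" for u v
    by (induction u) (auto simp: lval val H.m_assoc)
  have eq: "word_val H f u = word_val H f v" if "word_eq R u v" for u v
    using that
  proof induction
    case (cancel x)
    show ?case
      by (cases x) (simp_all add: f)
  qed (simp_all add: rels append)
  define \<phi> where "\<phi> X = word_val H f (SOME w. w \<in> X)" for X
  have \<phi>: "\<phi> (word_class R u) = word_val H f u" for u
  proof -
    have "u \<in> word_class R u"
      by (simp add: word_class_def word_eq.refl)
    then have "(SOME w. w \<in> word_class R u) \<in> word_class R u"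
      by (rule someI)
    then have "word_eq R u (SOME w. w \<in> word_class R u)"
      by (simp add: word_class_def)
    from eq[OF this] show ?thesis
      by (simp add: \<phi>_def)
  qed
  have car: "carrier (presented_group R) = range (word_class R)"
    by (simp add: presented_group_def)
  have "\<phi> \<in> hom (presented_group R) H"
  proof (rule homI)
    fix X assume "X \<in> carrier (presented_group R)"
    then show "\<phi> X \<in> carrier H"
      by (auto simp: car \<phi> val)
  next
    fix X Y assume "X \<in> carrier (presented_group R)" "Y \<in> carrier (presented_group R)"
    then obtain u v where "X = word_class R u" "Y = word_class R v"
      by (auto simp: car)
    then show "\<phi> (X \<otimes>\<^bsub>presented_group R\<^esub> Y) = \<phi> X \<otimes>\<^bsub>H\<^esub> \<phi> Y"
      by (simp add: mult_word_class \<phi> append)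
  qed
  moreover have "\<forall>g. \<phi> (word_class R [Gen g]) = f g"
    by (simp add: \<phi> f)
  ultimately show ?thesis
    by blast
qed


section \<open>The quasidihedral group\<close>

datatype qd_gen = GenA | GenB

definition QD :: "nat \<Rightarrow> qd_gen letter list set monoid" where
  "QD n = presented_group
    {(replicate (2 ^ (n - 1)) (Gen GenA), []),
     ([Gen GenB, Gen GenB], []),
     ([Gen GenB, Gen GenA, Inv GenB], replicate (2 ^ (n - 2) - 1) (Gen GenA))}"


section \<open>The non-commuting graph\<close>

definition group_center :: "('a, 'b) monoid_scheme \<Rightarrow> 'a set" where
  "group_center G = {z \<in> carrier G. \<forall>x\<in>carrier G. z \<otimes>\<^bsub>G\<^esub> x = x \<otimes>\<^bsub>G\<^esub> z}"

text \<open>As in \<^locale>\<open>pair_graph\<close>, an undirected edge is a pair of opposite arcs; in particular the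
  degree of a vertex is its out-degree.\<close>

definition noncommuting_graph :: "('a, 'b) monoid_scheme \<Rightarrow> 'a pair_pre_digraph" where
  "noncommuting_graph G =
    \<lparr> pverts = carrier G - group_center G,
      parcs = {(x, y). x \<in> carrier G - group_center G \<and> y \<in> carrier G - group_center G \<and>
                       x \<otimes>\<^bsub>G\<^esub> y \<noteq> y \<otimes>\<^bsub>G\<^esub> x} \<rparr>"

lemma pair_graph_noncommuting_graph:
  assumes "finite (carrier G)"
  shows "pair_graph (noncommuting_graph G)"
proof
  have "parcs (noncommuting_graph G) \<subseteq> carrier G \<times> carrier G"
    by (auto simp: noncommuting_graph_def)
  then show "finite (parcs (noncommuting_graph G))"
    using assms by (simp add: finite_subset)
qed (use assms in \<open>auto simp: noncommuting_graph_def symmetric_def sym_def\<close>)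


section \<open>Laplacian spectrum\<close>

text \<open>The matrices are formed with respect to an enumeration \<open>vs\<close> of the vertices.\<close>

definition degree_matrix :: "'a pair_pre_digraph \<Rightarrow> 'a list \<Rightarrow> real mat" where
  "degree_matrix G vs = mat_diag (length vs) (\<lambda>i. real (out_degree G (vs ! i)))"

definition adjacency_matrix :: "'a pair_pre_digraph \<Rightarrow> 'a list \<Rightarrow> real mat" where
  "adjacency_matrix G vs =
    mat (length vs) (length vs) (\<lambda>(i, j). if (vs ! i, vs ! j) \<in> parcs G then 1 else 0)"

definition laplacian_matrix :: "'a pair_pre_digraph \<Rightarrow> 'a list \<Rightarrow> real mat" where
  "laplacian_matrix G vs = degree_matrix G vs - adjacency_matrix G vs"

text \<open>Eigenvalues with algebraic multiplicity. Only real roots of the characteristic polynomial are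
  listed, which are all of them if the matrix is symmetric, as a Laplacian matrix of a finite
  undirected graph is.\<close>

definition eigenvalue_mset :: "real mat \<Rightarrow> real multiset" where
  "eigenvalue_mset A = proots (char_poly A)"

text \<open>The enumeration is immaterial, see \<open>laplacian_spectrum_eq\<close> below.\<close>

definition laplacian_spectrum :: "'a pair_pre_digraph \<Rightarrow> real multiset" where
  "laplacian_spectrum G =
    eigenvalue_mset (laplacian_matrix G (SOME vs. distinct vs \<and> set vs = pverts G))"

lemma similar_mat_reindex:
  fixes f :: "'a \<Rightarrow> 'a \<Rightarrow> 'b :: comm_ring_1"
  assumes "distinct vs" "distinct ws" "set vs = set ws"
  shows "similar_mat (mat (length vs) (length vs) (\<lambda>(i, j). f (vs ! i) (vs ! j)))
                     (mat (length ws) (length ws) (\<lambda>(i, j). f (ws ! i) (ws ! j)))"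
proof -
  define n where "n = length vs"
  have len: "length vs = n" "length ws = n"
    using assms by (auto simp: n_def simp flip: distinct_card)
  define P where "P us us' = mat n n (\<lambda>(i, j). if us ! i = us' ! j then 1 else (0 :: 'b))"
    for us us' :: "'a list"
  have delta: "(\<Sum>k = 0..<n. (if x = us ! k then 1 else 0) * g (us ! k)) = (g x :: 'b)"
    if "distinct us" "length us = n" "x \<in> set us" for x g and us :: "'a list"
  proof -
    have "(\<Sum>k = 0..<n. (if x = us ! k then 1 else 0) * g (us ! k)) =
          (\<Sum>y\<in>set us. (if x = y then 1 else 0) * g y)"
      using bij_betw_nth[OF that(1), of "{..<n}" "set us"] that(2)
      by (intro sum.reindex_bij_betw) (simp add: lessThan_atLeast0)
    also have "\<dots> = (\<Sum>y\<in>set us. if x = y then g y else 0)"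
      by (intro sum.cong) auto
    also have "\<dots> = g x"
      using that(3) by simp
    finally show ?thesis .
  qed
  have inv: "P us us' * P us' us = 1\<^sub>m n"
    if "distinct us" "distinct us'" "set us = set us'" "length us = n" "length us' = n"
    for us us' :: "'a list"
  proof (rule eq_matI)
    fix i j assume ij: "i < dim_row (1\<^sub>m n :: 'b mat)" "j < dim_col (1\<^sub>m n :: 'b mat)"
    have "(P us us' * P us' us) $$ (i, j) =
      (\<Sum>k = 0..<n. (if us ! i = us' ! k then 1 else 0) * (if us' ! k = us ! j then 1 else 0))"
      using ij by (simp add: P_def scalar_prod_def)
    also have "\<dots> = (if us ! i = us ! j then 1 else 0)"
    proof (rule delta[OF that(2,5)])
      show "us ! i \<in> set us'"
        using ij that(4) unfolding that(3)[symmetric] by simp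
    qed
    also have "\<dots> = 1\<^sub>m n $$ (i, j)"
      using ij that(1,4) by (simp add: nth_eq_iff_index_eq)
    finally show "(P us us' * P us' us) $$ (i, j) = 1\<^sub>m n $$ (i, j)" .
  qed (auto simp: P_def)
  let ?M = "\<lambda>us. mat n n (\<lambda>(i, j). f (us ! i) (us ! j))"
  have PM: "P vs ws * ?M ws = mat n n (\<lambda>(i, j). f (vs ! i) (ws ! j))"
  proof (rule eq_matI)
    let ?N = "mat n n (\<lambda>(i, j). f (vs ! i) (ws ! j))"
    fix i j assume "i < dim_row ?N" "j < dim_col ?N"
    then have ij: "i < n" "j < n"
      by auto
    then have "(P vs ws * ?M ws) $$ (i, j) =
      (\<Sum>k = 0..<n. (if vs ! i = ws ! k then 1 else 0) * f (ws ! k) (ws ! j))"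
      by (simp add: P_def scalar_prod_def)
    also have "\<dots> = f (vs ! i) (ws ! j)"
    proof (rule delta[OF assms(2) len(2)])
      show "vs ! i \<in> set ws"
        using ij len(1) unfolding assms(3)[symmetric] by simp
    qed
    finally show "(P vs ws * ?M ws) $$ (i, j) = ?N $$ (i, j)"
      using ij by simp
  qed (auto simp: P_def)
  have "?M vs = P vs ws * ?M ws * P ws vs"
    unfolding PM
  proof (rule eq_matI)
    let ?N = "mat n n (\<lambda>(i, j). f (vs ! i) (ws ! j)) * P ws vs"
    fix i j assume "i < dim_row ?N" "j < dim_col ?N"
    then have ij: "i < n" "j < n"
      by (auto simp: P_def)
    then have "?N $$ (i, j) =
      (\<Sum>k = 0..<n. f (vs ! i) (ws ! k) * (if ws ! k = vs ! j then 1 else 0))"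
      by (simp add: P_def scalar_prod_def)
    also have "\<dots> = (\<Sum>k = 0..<n. (if vs ! j = ws ! k then 1 else 0) * f (vs ! i) (ws ! k))"
      by (intro sum.cong) auto
    also have "\<dots> = f (vs ! i) (vs ! j)"
    proof (rule delta[OF assms(2) len(2)])
      show "vs ! j \<in> set ws"
        using ij len(1) unfolding assms(3)[symmetric] by simp
    qed
    finally show "?M vs $$ (i, j) = ?N $$ (i, j)"
      using ij by simp
  qed (auto simp: P_def)
  then show ?thesis
    unfolding len
    by (intro similar_matI[of _ _ "P vs ws" "P ws vs" n] inv assms assms(3)[symmetric] len)
       (auto simp: P_def)
qed

lemma laplacian_spectrum_eq:
  assumes "distinct vs" "set vs = pverts G"
  shows "laplacian_spectrum G = eigenvalue_mset (laplacian_matrix G vs)"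
proof -
  define ws where "ws = (SOME vs. distinct vs \<and> set vs = pverts G)"
  have ws: "distinct ws \<and> set ws = pverts G"
    unfolding ws_def by (rule someI[of _ vs]) (use assms in auto)
  let ?f = "\<lambda>x y. (if x = y then real (out_degree G x) else 0) - (if (x, y) \<in> parcs G then 1 else 0)"
  have L: "laplacian_matrix G us = mat (length us) (length us) (\<lambda>(i, j). ?f (us ! i) (us ! j))"
    if "distinct us" for us
    by (rule eq_matI)
       (use that in \<open>auto simp: laplacian_matrix_def degree_matrix_def adjacency_matrix_def
          mat_diag_def nth_eq_iff_index_eq\<close>)
  have "similar_mat (laplacian_matrix G ws) (laplacian_matrix G vs)"
    using similar_mat_reindex[of ws vs ?f] ws assms by (simp only: L)
  then show ?thesis
    by (simp add: laplacian_spectrum_def eigenvalue_mset_def char_poly_similar flip: ws_def)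
qed

end

theory Submission
  imports Defs
begin

text \<open>
  Outside the centre \<open>{1, a^(2^(n-2))}\<close>, two elements of the quasidihedral group commute iff both are
  powers of \<open>a\<close> or they are \<open>a^i b\<close> and \<open>a^j b\<close> with \<open>i\<close> and \<open>j\<close> congruent modulo \<open>2^(n-2)\<close>. So the
  non-commuting graph is complete multipartite, with one part of size \<open>2^(n-1) - 2\<close> and \<open>2^(n-2)\<close>
  parts of size 2.

  In a complete multipartite graph on \<open>m\<close> vertices, choose a representative in each part. If \<open>r\<close>
  represents the part of \<open>i\<close>, of size \<open>s\<close>, then \<open>e_i - e_r\<close> is an eigenvector of the Laplacian for
  \<open>m - s\<close>. Modulo these vectors, the differences of representatives are eigenvectors for \<open>m\<close>, and
  modulo both kinds a single representative spans the kernel. Hence the Laplacian is triangular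
  in this basis, and its spectrum can be read off.
\<close>


section \<open>Laplacian spectra of complete multipartite graphs\<close>

text \<open>A nonsingular \<open>P\<close> is invertible over a field, so checking
  \<open>A * P = P * B\<close> suffices and the inverse change of basis never has to be
  computed.\<close>

lemma similar_mat_intertwine:
  fixes A B P :: "'a :: field mat"
  assumes "A \<in> carrier_mat n n" "B \<in> carrier_mat n n" "P \<in> carrier_mat n n"
    and "det P \<noteq> 0" "A * P = P * B"
  shows "similar_mat A B"
proof -
  obtain Q where Q: "Q \<in> carrier_mat n n" "P * Q = 1\<^sub>m n" "Q * P = 1\<^sub>m n"
    using det_non_zero_imp_unit[OF assms(3,4), of "()"]
    by (auto simp: Units_def ring_mat_def)
  have "P * B * Q = A * (P * Q)"
    using assms Q(1) by (simp flip: assms(5))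
  also have "\<dots> = A"
    using assms(1) by (simp add: Q(2))
  finally show ?thesis
    using assms Q by (intro similar_matI[of _ _ P Q n]) auto
qed

lemma sum_indicator_real: "finite A \<Longrightarrow> (\<Sum>x\<in>A. if P x then 1 else 0) = real (card {x \<in> A. P x})"
  by (simp add: sum.inter_filter[symmetric])

lemma out_degree_eq_card:
  fixes G :: "'a pair_pre_digraph"
  assumes "parcs G \<subseteq> pverts G \<times> pverts G"
  shows "out_degree G x = card {y \<in> pverts G. (x, y) \<in> parcs G}"
proof -
  have "out_arcs G x = Pair x ` {y \<in> pverts G. (x, y) \<in> parcs G}"
    using assms by (auto simp: out_arcs_def)
  then show ?thesis
    by (simp add: out_degree_def card_image inj_on_def)
qed

text \<open>If the vertices of \<open>H\<close> are enumerated as the images under \<open>f\<close>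
  of those of \<open>G\<close>, the two Laplacian matrices agree entry by entry.\<close>

lemma laplacian_spectrum_iso:
  fixes G :: "'a pair_pre_digraph" and H :: "'b pair_pre_digraph"
  assumes fin: "finite (pverts G)" and bij: "bij_betw f (pverts G) (pverts H)"
    and G: "parcs G \<subseteq> pverts G \<times> pverts G" and H: "parcs H \<subseteq> pverts H \<times> pverts H"
    and arcs: "\<And>x y. x \<in> pverts G \<Longrightarrow> y \<in> pverts G \<Longrightarrow> (f x, f y) \<in> parcs H \<longleftrightarrow> (x, y) \<in> parcs G"
  shows "laplacian_spectrum G = laplacian_spectrum H"
proof -
  obtain vs where vs: "set vs = pverts G" "distinct vs"
    using finite_distinct_list[OF fin] by blast
  have f_vs: "set (map f vs) = pverts H" "distinct (map f vs)"
    using bij vs by (auto simp: bij_betw_def distinct_map)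
  have deg: "out_degree H (f x) = out_degree G x" if x: "x \<in> pverts G" for x
  proof -
    have "{y \<in> pverts H. (f x, y) \<in> parcs H} = f ` {y \<in> pverts G. (x, y) \<in> parcs G}"
      unfolding bij_betw_imp_surj_on[OF bij, symmetric] using arcs[OF x] by auto
    moreover have "inj_on f {y \<in> pverts G. (x, y) \<in> parcs G}"
      using bij by (auto simp: bij_betw_def inj_on_def)
    ultimately show ?thesis
      by (simp add: out_degree_eq_card G H card_image)
  qed
  have mem: "vs ! i \<in> pverts G" if "i < length vs" for i
    using nth_mem[OF that] by (simp only: vs(1))
  have "laplacian_matrix H (map f vs) = laplacian_matrix G vs"
  proof (rule eq_matI)
    fix i j assume "i < dim_row (laplacian_matrix G vs)" "j < dim_col (laplacian_matrix G vs)"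
    then have ij: "i < length vs" "j < length vs"
      by (simp_all add: laplacian_matrix_def adjacency_matrix_def)
    show "laplacian_matrix H (map f vs) $$ (i, j) = laplacian_matrix G vs $$ (i, j)"
      using ij deg[OF mem[OF ij(1)]] arcs[OF mem[OF ij(1)] mem[OF ij(2)]]
      by (cases "i = j") (simp_all add: laplacian_matrix_def degree_matrix_def adjacency_matrix_def mat_diag_def)
  qed (simp_all add: laplacian_matrix_def adjacency_matrix_def)
  then show ?thesis
    using vs f_vs by (simp add: laplacian_spectrum_eq[of vs] laplacian_spectrum_eq[of "map f vs"])
qed

section \<open>Triangularising the Laplacian of a complete multipartite graph\<close>

text \<open>Here \<open>c i\<close> names the part of vertex \<open>i\<close>, and the indices from
  \<open>r\<close> on form a transversal of the parts. Placing the representatives last makes the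
  change of basis lower triangular and the resulting matrix upper triangular.\<close>

lemma eigenvalue_mset_multipartite:
  fixes c :: "nat \<Rightarrow> 'c" and r m :: nat and s :: "'c \<Rightarrow> real"
  assumes r: "r < m" and inj: "inj_on c {r..<m}" and rep: "c ` {..<r} \<subseteq> c ` {r..<m}"
  defines "s \<equiv> \<lambda>x. real (card {k. k < m \<and> c k = x})"
  shows "eigenvalue_mset (mat m m (\<lambda>(i, j).
      (if i = j then m - s (c i) else 0) - (if c i \<noteq> c j then 1 else 0))) =
    {#0#} + replicate_mset (m - r - 1) (real m) + {#m - s (c i). i \<in># mset [0..<r]#}"
proof -
  \<comment> \<open>The last representative \<open>l\<close> keeps its unit vector; every other
    \<open>e_i\<close> is replaced by a difference.\<close>
  define l where "l = m - 1"
  have m: "m = Suc l" and rl: "r \<le> l"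
    using r by (auto simp: l_def)
  define D where "D i j = (if i = j then 1 else 0 :: real)" for i j :: nat
  define E where "E i j = (if c i = c j then 1 else 0 :: real)" for i j :: nat
  define L where "L i j = D i j * (m - s (c i)) - (1 - E i j)" for i j
  have rep': "\<exists>q. r \<le> q \<and> q \<le> l \<and> c q = c i" if "i < r" for i
    using rep that by (force simp: m image_iff subset_iff less_Suc_eq_le)
  \<comment> \<open>\<open>e_(q i)\<close> is what gets subtracted from \<open>e_i\<close>: a
    non-representative is paired with the representative of its part, any other representative with
    \<open>l\<close>.\<close>
  define q where "q i = (if i < r then SOME k. r \<le> k \<and> k \<le> l \<and> c k = c i else l)" for i
  have q: "r \<le> q i" "q i \<le> l" "c (q i) = c i" if "i < r" for i
    using someI_ex[OF rep'[OF that]] that by (auto simp: q_def)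
  have q_l: "q i = l" if "r \<le> i" for i
    using that by (simp add: q_def)
  have E_D: "E i j = D i j" if "r \<le> i" "r \<le> j" "i \<le> l" "j \<le> l" for i j
    using inj that by (auto simp: E_def D_def m inj_on_def)
  have q_eq: "D i (q j) = E i j" if "j < r" "r \<le> i" "i \<le> l" for i j
    using E_D[of i "q j"] q[OF that(1)] that by (simp add: E_def)
  \<comment> \<open>The columns of \<open>P\<close> are the basis vectors, and \<open>T\<close> is the Laplacian in this basis; the indices below
    \<open>r\<close> are the non-representatives.\<close>
  define P where "P i j = D i j - (if j < l then D i (q j) else 0)" for i j
  define T where "T i j =
    (if j < r then D i j * (m - s (c j))
     else if j < l then (if i < r then E i j - E i l else m * D i j)
     else if i < r then E i l - 1 else if i < l then - s (c i) else 0)" for i j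
  \<comment> \<open>Only non-representatives are counted; each part has exactly one representative,
    hence the gap of one between \<open>s'\<close> and \<open>s\<close>.\<close>
  define s' where "s' x = (\<Sum>k<r. if c k = x then 1 else 0 :: real)" for x
  have s_s': "s (c i) = s' (c i) + 1" if "r \<le> i" "i \<le> l" for i
  proof -
    have "s (c i) = (\<Sum>k<m. if c k = c i then 1 else 0)"
      by (simp add: s_def sum_indicator_real)
    also have "{..<m} = {..<r} \<union> {r..<m}"
      using r by auto
    also have "(\<Sum>k\<in>\<dots>. if c k = c i then 1 else 0 :: real) =
        s' (c i) + (\<Sum>k\<in>{r..<m}. if c k = c i then 1 else 0)"
      by (subst sum.union_disjoint) (auto simp: s'_def)
    also have "(\<Sum>k\<in>{r..<m}. if c k = c i then 1 else 0 :: real) = (\<Sum>k\<in>{r..<m}. if k = i then 1 else 0)"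
      using that inj by (intro sum.cong) (auto simp: m inj_on_def)
    also have "\<dots> = 1"
      using that by (simp add: m)
    finally show ?thesis .
  qed
  \<comment> \<open>The parts partition the \<open>m\<close> vertices and each has one
    representative, so the sizes taken over all representatives add up to \<open>m\<close>.\<close>
  have sum_s: "(\<Sum>k\<in>{r..<l}. s (c k)) = m - s (c l)"
  proof -
    have "(\<Sum>k\<in>{r..<l}. s (c k)) + s (c l) = (\<Sum>k\<in>{r..<m}. s (c k))"
      using rl by (simp add: m)
    also have "\<dots> = (\<Sum>x\<in>c ` {r..<m}. s x)"
      using inj by (simp add: sum.reindex)
    also have "\<dots> = real (\<Sum>x\<in>c ` {r..<m}. card {k \<in> {..<m}. c k = x})"
      by (simp add: s_def)
    also have "(\<Sum>x\<in>c ` {r..<m}. card {k \<in> {..<m}. c k = x}) = card {..<m}"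
    proof -
      have "c ` {..<m} \<subseteq> c ` {r..<m}"
        using rep by (auto simp: image_subset_iff) (metis atLeastLessThan_iff imageI lessThan_iff linorder_not_less)
      from sum_fun_comp[OF _ _ this, of "\<lambda>_. 1 :: nat"] show ?thesis
        by simp
    qed
    finally show ?thesis by simp
  qed
  define LM PM TM where "LM = mat m m (\<lambda>(i, j). L i j)"
    and "PM = mat m m (\<lambda>(i, j). P i j)" and "TM = mat m m (\<lambda>(i, j). T i j)"
  \<comment> \<open>The second nonzero entry of column \<open>i\<close> of \<open>P\<close> sits in
    row \<open>q i\<close>, below the diagonal, so \<open>P\<close> is lower triangular with unit
    diagonal.\<close>
  have q_gt: "i < q i" if "i < l" for i
    using q(1)[of i] q_l[of i] that by (cases "i < r") auto
  have "det PM = prod_list (diag_mat PM)"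
  proof (rule det_lower_triangular)
    fix i j assume "i < j" "j < m"
    then show "PM $$ (i, j) = 0"
      using q_gt[of j] by (auto simp: PM_def P_def D_def)
  qed (simp add: PM_def)
  also have "diag_mat PM = map (\<lambda>_. 1) [0..<m]"
    using q_gt by (force simp: diag_mat_def PM_def P_def D_def)
  finally have det: "det PM \<noteq> 0"
    by (simp add: map_replicate_const)
  have "LM * PM = PM * TM"
  proof (rule eq_matI)
    fix i j assume "i < dim_row (PM * TM)" "j < dim_col (PM * TM)"
    then have ij: "i \<le> l" "j \<le> l"
      by (auto simp: PM_def TM_def m)
    have q_le: "q k \<le> l" for k
      using q(2)[of k] by (auto simp: q_def)
    have sumD: "(\<Sum>k<m. f k * D k x) = f x" "(\<Sum>k<m. D x k * f k) = f x" if "x \<le> l" for f x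
      using that by (auto simp: D_def m if_distrib if_distribR cong: if_cong)
    have "(LM * PM) $$ (i, j) = (\<Sum>k<m. L i k * P k j)"
      using ij by (simp add: LM_def PM_def scalar_prod_def lessThan_atLeast0 m)
    also have "\<dots> = L i j - (if j < l then L i (q j) else 0)"
      using sumD(1) ij q_le[of j] by (simp add: P_def right_diff_distrib sum_subtractf)
    finally have lhs: "(LM * PM) $$ (i, j) = L i j - (if j < l then L i (q j) else 0)" .
    have "(PM * TM) $$ (i, j) = (\<Sum>k<m. P i k * T k j)"
      using ij by (simp add: TM_def PM_def scalar_prod_def lessThan_atLeast0 m)
    also have "\<dots> = T i j - (\<Sum>k<m. (if k < l then D i (q k) else 0) * T k j)"
      using sumD(2) ij by (simp add: P_def left_diff_distrib sum_subtractf)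
    also have "(\<Sum>k<m. (if k < l then D i (q k) else 0) * T k j) = (\<Sum>k<l. D i (q k) * T k j)"
      by (simp add: m)
    also have "{..<l} = {..<r} \<union> {r..<l}"
      using rl by auto
    also have "(\<Sum>k\<in>\<dots>. D i (q k) * T k j) =
        (\<Sum>k<r. D i (q k) * T k j) + (\<Sum>k\<in>{r..<l}. D i l * T k j)"
      by (subst sum.union_disjoint) (auto simp: q_l)
    finally have rhs: "(PM * TM) $$ (i, j) =
      T i j - ((\<Sum>k<r. D i (q k) * T k j) + D i l * (\<Sum>k\<in>{r..<l}. T k j))"
      by (simp add: sum_distrib_left)
    have E_mult: "E i k * E k x = E i k * E i x" for k x
      by (auto simp: E_def)
    have sumE: "(\<Sum>k<r. E i k) = s' (c i)"
      by (auto simp: s'_def E_def intro!: sum.cong)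
    \<comment> \<open>For \<open>k < r\<close>, \<open>q k\<close> is a representative, so rows
      \<open>i < r\<close> receive nothing; for a representative \<open>i\<close>,
      \<open>q k = i\<close> says that \<open>k\<close> lies in its part.\<close>
    have D_q: "(\<Sum>k<r. D i (q k) * T k j) = (if i < r then 0 else \<Sum>k<r. E i k * T k j)"
      using q(1) q_eq ij by (fastforce simp: D_def intro!: sum.cong sum.neutral)
    consider "j < r" | "r \<le> j" "j < l" | "j = l"
      using ij by linarith
    then show "(LM * PM) $$ (i, j) = (PM * TM) $$ (i, j)"
    proof cases
      \<comment> \<open>Vertices \<open>j\<close> and \<open>q j\<close> share a part, so their
        adjacency columns agree and the difference is a genuine eigenvector.\<close>
      case 1
      have "(\<Sum>k<r. E i k * T k j) = (\<Sum>k<r. if k = j then E i j * (m - s (c j)) else 0)"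
        using 1 by (intro sum.cong) (auto simp: T_def D_def)
      then have a: "(\<Sum>k<r. E i k * T k j) = E i j * (m - s (c j))"
        using 1 by simp
      have b: "(\<Sum>k\<in>{r..<l}. T k j) = 0"
        using 1 by (auto simp: T_def D_def intro: sum.neutral)
      show ?thesis
      proof (cases "i < r")
        case True
        then show ?thesis
          using 1 rl q[of j] unfolding lhs rhs D_q b by (auto simp: T_def L_def D_def E_def)
      next
        case False
        then show ?thesis
          using 1 rl q[of j] q_eq[of j i] ij
          unfolding lhs rhs D_q a b by (auto simp: T_def L_def D_def E_def)
      qed
    next
      \<comment> \<open>For a representative \<open>j\<close>, \<open>L e_j\<close> is
        \<open>m e_j - u\<close> plus the sum of \<open>e_k - e_j\<close> over the other
        \<open>k\<close> in its part, where \<open>u\<close> is the all-ones vector. Subtracting the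
        same formula for \<open>l\<close> cancels \<open>u\<close> and leaves only \<open>m\<close>
        times the basis vector and columns below \<open>r\<close>.\<close>
      case 2
      have "(\<Sum>k<r. E i k * T k j) = (\<Sum>k<r. E i k * (E i j - E i l))"
        using 2 by (intro sum.cong) (auto simp: T_def right_diff_distrib E_mult)
      then have a: "(\<Sum>k<r. E i k * T k j) = s' (c i) * (E i j - E i l)"
        by (simp add: sumE flip: sum_distrib_right)
      have "(\<Sum>k\<in>{r..<l}. T k j) = (\<Sum>k\<in>{r..<l}. if k = j then real m else 0)"
        using 2 by (intro sum.cong) (auto simp: T_def D_def)
      then have b: "(\<Sum>k\<in>{r..<l}. T k j) = m"
        using 2 by simp
      show ?thesis
      proof (cases "i < r")
        case True
        then show ?thesis
          using 2 rl unfolding lhs rhs D_q b by (auto simp: T_def L_def D_def q_l)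
      next
        case False
        then show ?thesis
          using 2 rl ij s_s'[of i]
          unfolding lhs rhs D_q a b by (auto simp: T_def L_def q_l E_D) (auto simp: D_def)
      qed
    next
      \<comment> \<open>The same formula for \<open>L e_l\<close>, with \<open>u\<close> expanded in
        the basis: basis vectors below \<open>r\<close> occur once, the one at a representative
        \<open>i < l\<close> occurs \<open>s (c i)\<close> times, and \<open>e_l\<close> occurs
        \<open>m\<close> times, which cancels \<open>m e_l\<close>.\<close>
      case 3
      have "(\<Sum>k<r. E i k * T k j) = (\<Sum>k<r. E i k * (E i l - 1))"
        using 3 rl by (intro sum.cong) (auto simp: T_def right_diff_distrib E_mult)
      then have a: "(\<Sum>k<r. E i k * T k j) = s' (c i) * (E i l - 1)"
        by (simp add: sumE flip: sum_distrib_right)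
      have b: "(\<Sum>k\<in>{r..<l}. T k j) = - (m - s (c l))"
        unfolding sum_s[symmetric] using 3 by (auto simp: T_def simp flip: sum_negf intro: sum.cong)
      show ?thesis
      proof (cases "i < r")
        case True
        then show ?thesis
          using 3 rl unfolding lhs rhs D_q b by (auto simp: T_def L_def D_def)
      next
        case False
        then show ?thesis
          using 3 rl ij s_s'[of i]
          unfolding lhs rhs D_q a b by (auto simp: T_def L_def q_l E_D) (auto simp: D_def)
      qed
    qed
  qed (auto simp: LM_def PM_def TM_def)
  then have "similar_mat LM TM"
    using det by (intro similar_mat_intertwine[of _ m _ PM]) (auto simp: LM_def PM_def TM_def)
  then have "eigenvalue_mset LM = proots (char_poly TM)"
    by (simp add: eigenvalue_mset_def char_poly_similar)
  also have "char_poly TM = (\<Prod>a\<leftarrow>diag_mat TM. [:- a, 1:])"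
  proof (rule char_poly_upper_triangular[of _ m])
    show "upper_triangular TM"
      using rl by (auto simp: TM_def upper_triangular_def T_def D_def m)
  qed (simp add: TM_def)
  also have "proots \<dots> = mset (diag_mat TM)"
  proof -
    have "(\<Prod>a\<leftarrow>as. [:- a, 1:]) \<noteq> 0" for as :: "real list"
      by (auto simp: prod_list_zero_iff)
    then have "proots (\<Prod>a\<leftarrow>as. [:- a, 1:]) = mset as" for as :: "real list"
      by (induction as) (simp_all add: proots_mult del: mult_pCons_left)
    then show ?thesis .
  qed
  also have "diag_mat TM = map (\<lambda>i. m - s (c i)) [0..<r] @ map (\<lambda>_. real m) [r..<l] @ [0]"
  proof -
    have "[0..<m] = [0..<r] @ [r..<l] @ [l]"
      using rl upt_add_eq_append[of 0 r "l - r"] by (simp add: m)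
    moreover have "diag_mat TM = map (\<lambda>i. T i i) [0..<m]"
      by (simp add: diag_mat_def TM_def)
    ultimately show ?thesis
      using rl by (auto simp: T_def D_def)
  qed
  also have "mset \<dots> = {#0#} + replicate_mset (m - r - 1) (real m) + {#m - s (c i). i \<in># mset [0..<r]#}"
    by (simp add: map_replicate_const m del: mset_upt)
  also have "LM = mat m m (\<lambda>(i, j).
      (if i = j then m - s (c i) else 0) - (if c i \<noteq> c j then 1 else 0))"
    by (rule eq_matI) (auto simp: LM_def L_def D_def E_def)
  finally show ?thesis .
qed


text \<open>\<open>p\<close> labels the parts and \<open>R\<close> is a transversal. Enumerating the
  vertices of \<open>R\<close> last yields exactly the matrix of
  \<open>eigenvalue_mset_multipartite\<close>.\<close>

lemma laplacian_spectrum_multipartite: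
  fixes G :: "'a pair_pre_digraph" and p :: "'a \<Rightarrow> 'c"
  assumes fin: "finite (pverts G)"
    and arcs: "parcs G = {(x, y). x \<in> pverts G \<and> y \<in> pverts G \<and> p x \<noteq> p y}"
    and R: "R \<subseteq> pverts G" "R \<noteq> {}" "inj_on p R" "p ` pverts G \<subseteq> p ` R"
  shows "laplacian_spectrum G =
    {#0#} + replicate_mset (card R - 1) (real (card (pverts G))) +
    {#real (card (pverts G)) - real (card {y \<in> pverts G. p y = p x}). x \<in># mset_set (pverts G - R)#}"
proof -
  define V where "V = pverts G"
  have finR: "finite R"
    using fin R(1) finite_subset by blast
  obtain ws us where ws: "set ws = V - R" "distinct ws" and us: "set us = R" "distinct us"
    using finite_distinct_list fin finR by (metis V_def finite_Diff)
  define vs where "vs = ws @ us"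
  have vs: "set vs = V" "distinct vs"
    using ws us R(1) by (auto simp: vs_def V_def)
  define r m where "r = length ws" and "m = length vs"
  have m: "m = card V" and mr: "m = r + card R"
    using distinct_card[OF vs(2)] distinct_card[OF us(2)] vs(1) us(1) by (simp_all add: m_def r_def vs_def)
  have rm: "r < m"
    using mr finR R(2) by (simp add: card_gt_0_iff)
  define c where "c i = p (vs ! i)" for i
  have mem: "vs ! i \<in> V" if "i < m" for i
    using that vs(1) by (auto simp: m_def)
  have imR: "(!) vs ` {r..<m} = R"
  proof -
    have "{r..<m} = (+) r ` {0..<length us}"
      by (simp add: m_def r_def vs_def add.commute)
    then have "(!) vs ` {r..<m} = (!) us ` {0..<length us}"
      by (simp only: image_image) (simp add: vs_def r_def nth_append)
    also have "\<dots> = R"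
      by (simp add: nth_image us)
    finally show ?thesis .
  qed
  have inj_vs: "inj_on ((!) vs) {..<m}"
    using vs(2) by (simp add: m_def inj_on_nth)
  have card_fibre: "card {k. k < m \<and> c k = p x} = card {y \<in> V. p y = p x}" for x
  proof -
    have "{y \<in> V. p y = p x} = (!) vs ` {k. k < m \<and> c k = p x}"
      unfolding vs(1)[symmetric] by (auto simp: c_def in_set_conv_nth m_def)
    moreover have "inj_on ((!) vs) {k. k < m \<and> c k = p x}"
      using inj_vs by (rule inj_on_subset) auto
    ultimately show ?thesis
      by (simp add: card_image)
  qed
  have deg: "real (out_degree G x) = real m - real (card {y \<in> V. p y = p x})" if "x \<in> V" for x
  proof -
    have "out_degree G x = card (V - {y \<in> V. p y = p x})"
      using that by (subst out_degree_eq_card) (auto simp: arcs V_def intro!: arg_cong[where f = card])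
    moreover have "card {y \<in> V. p y = p x} \<le> card V"
      using fin by (intro card_mono) (auto simp: V_def)
    ultimately show ?thesis
      using fin by (simp add: card_Diff_subset m V_def of_nat_diff)
  qed
  have "laplacian_matrix G vs = mat m m (\<lambda>(i, j).
      (if i = j then real m - real (card {k. k < m \<and> c k = c i}) else 0) - (if c i \<noteq> c j then 1 else 0))"
    (is "_ = ?M")
  proof (rule eq_matI)
    fix i j assume "i < dim_row ?M" "j < dim_col ?M"
    then have ij: "i < m" "j < m"
      by simp_all
    have "vs ! i = vs ! j \<longleftrightarrow> i = j"
      using ij vs(2) by (simp add: m_def nth_eq_iff_index_eq)
    moreover have "(vs ! i, vs ! j) \<in> parcs G \<longleftrightarrow> c i \<noteq> c j"
      using mem[OF ij(1)] mem[OF ij(2)] by (simp add: arcs c_def V_def)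
    ultimately show "laplacian_matrix G vs $$ (i, j) = ?M $$ (i, j)"
      using ij deg[OF mem[OF ij(1)]] card_fibre[of "vs ! i"]
      by (cases "i = j") (simp_all add: laplacian_matrix_def degree_matrix_def adjacency_matrix_def mat_diag_def
          c_def m_def)
  qed (simp_all add: laplacian_matrix_def adjacency_matrix_def m_def)
  moreover have "inj_on c {r..<m}"
  proof -
    have "inj_on (p \<circ> (!) vs) {r..<m}"
      using R(3) inj_vs by (intro comp_inj_on) (auto simp: imR inj_on_def)
    then show ?thesis
      by (simp add: c_def[abs_def] comp_def)
  qed
  moreover have "c ` {..<r} \<subseteq> c ` {r..<m}"
  proof -
    have "c ` {r..<m} = p ` R"
      by (simp add: c_def[abs_def] imR[symmetric] image_image)
    then show ?thesis
      using R(4) mem rm by (fastforce simp: c_def V_def)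
  qed
  ultimately have "laplacian_spectrum G = {#0#} + replicate_mset (m - r - 1) (real m) +
      {#real m - real (card {k. k < m \<and> c k = c i}). i \<in># mset [0..<r]#}"
    using eigenvalue_mset_multipartite[OF rm, of c] vs
    by (simp add: laplacian_spectrum_eq[of vs] V_def)
  also have "{#real m - real (card {k. k < m \<and> c k = c i}). i \<in># mset [0..<r]#} =
      {#real m - real (card {y \<in> V. p y = p x}). x \<in># mset (map ((!) vs) [0..<r])#}"
    by (simp add: c_def card_fibre[unfolded c_def] image_mset.compositionality comp_def)
  also have "map ((!) vs) [0..<r] = ws"
    by (rule nth_equalityI) (auto simp: r_def vs_def nth_append)
  also have "mset ws = mset_set (V - R)"
    using mset_set_set[OF ws(2)] ws(1) by simp
  finally show ?thesis
    using mr by (simp add: m V_def)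
qed


section \<open>The quasidihedral group\<close>

text \<open>An isomorphism preserves and reflects commutation, hence matches the centres and
  restricts to an isomorphism of the graphs.\<close>

lemma laplacian_spectrum_noncommuting_graph_iso:
  assumes \<phi>: "\<phi> \<in> iso G H" and fin: "finite (carrier G)" and "monoid G"
  shows "laplacian_spectrum (noncommuting_graph G) = laplacian_spectrum (noncommuting_graph H)"
proof (rule laplacian_spectrum_iso[of _ \<phi>])
  interpret G: monoid G by fact
  have bij: "bij_betw \<phi> (carrier G) (carrier H)" and hom: "\<phi> \<in> hom G H"
    using \<phi> by (auto simp: iso_def)
  have img: "carrier H = \<phi> ` carrier G"
    using bij by (simp add: bij_betw_def)
  have commute: "\<phi> x \<otimes>\<^bsub>H\<^esub> \<phi> y = \<phi> y \<otimes>\<^bsub>H\<^esub> \<phi> x \<longleftrightarrow> x \<otimes>\<^bsub>G\<^esub> y = y \<otimes>\<^bsub>G\<^esub> x"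
    if "x \<in> carrier G" "y \<in> carrier G" for x y
    using that bij_betw_imp_inj_on[OF bij] by (simp flip: hom_mult[OF hom] add: inj_on_eq_iff)
  then have center: "\<phi> x \<in> group_center H \<longleftrightarrow> x \<in> group_center G" if "x \<in> carrier G" for x
    using that by (auto simp: group_center_def img)
  show "finite (pverts (noncommuting_graph G))"
    using fin by (simp add: noncommuting_graph_def)
  have "\<phi> ` (carrier G - group_center G) = carrier H - group_center H"
    using center by (auto simp: img)
  then show "bij_betw \<phi> (pverts (noncommuting_graph G)) (pverts (noncommuting_graph H))"
    using bij by (auto simp: noncommuting_graph_def bij_betw_def inj_on_def)
  show "(\<phi> x, \<phi> y) \<in> parcs (noncommuting_graph H) \<longleftrightarrow> (x, y) \<in> parcs (noncommuting_graph G)"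
    if "x \<in> pverts (noncommuting_graph G)" "y \<in> pverts (noncommuting_graph G)" for x y
    using that commute[of x y] center by (auto simp: noncommuting_graph_def img)
qed (auto simp: noncommuting_graph_def)

section \<open>A concrete model of the group\<close>

text \<open>The pair \<open>(i, s)\<close> stands for \<open>a^i\<close> if \<open>s\<close> is false and for \<open>a^i b\<close> if it is true, where \<open>a\<close> has
  order \<open>8k\<close>. For \<open>k = 2^(n - 4)\<close> this is the quasidihedral group of order \<open>2^n\<close>; that \<open>k\<close> is a power
  of two plays no role in the commutation relations.\<close>

definition SD :: "int \<Rightarrow> (int \<times> bool) monoid" where
  "SD k =
    \<lparr> carrier = {0..<8 * k} \<times> UNIV,
      monoid.mult = (\<lambda>(i, s) (j, t). ((i + (if s then 4 * k - 1 else 1) * j) mod (8 * k), s \<noteq> t)),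
      one = (0, False) \<rparr>"

lemma SD_simps:
  "carrier (SD k) = {0..<8 * k} \<times> UNIV"
  "(i, s) \<otimes>\<^bsub>SD k\<^esub> (j, t) = ((i + (if s then 4 * k - 1 else 1) * j) mod (8 * k), s \<noteq> t)"
  "\<one>\<^bsub>SD k\<^esub> = (0, False)"
  by (simp_all add: SD_def)

text \<open>Associativity comes down to \<open>(4k - 1)^2 = 1\<close> modulo \<open>8k\<close>:
  conjugation by \<open>b\<close> is an involution on the powers of \<open>a\<close>.\<close>

lemma group_SD:
  assumes "k > 0"
  shows "group (SD k)"
proof (rule groupI)
  define e where "e s = (if s then 4 * k - 1 else 1)" for s
  have e: "(e (s \<noteq> t) * x) mod (8 * k) = (e s * (e t * x)) mod (8 * k)" for s t x
  proof -
    have "(4 * k - 1) * ((4 * k - 1) * x) = x + 8 * k * ((2 * k - 1) * x)"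
      by (simp add: algebra_simps)
    then show ?thesis
      by (cases s; cases t) (simp_all add: e_def)
  qed
  have mult: "(i, s) \<otimes>\<^bsub>SD k\<^esub> (j, t) = ((i + e s * j) mod (8 * k), s \<noteq> t)" for i j s t
    by (simp add: SD_simps e_def)
  fix x assume "x \<in> carrier (SD k)"
  then obtain i s where x: "x = (i, s)" "0 \<le> i" "i < 8 * k"
    by (cases x) (auto simp: SD_simps)
  then show "\<one>\<^bsub>SD k\<^esub> \<otimes>\<^bsub>SD k\<^esub> x = x"
    by (simp add: SD_simps)
  show "\<exists>y\<in>carrier (SD k). y \<otimes>\<^bsub>SD k\<^esub> x = \<one>\<^bsub>SD k\<^esub>"
    using assms
    by (intro bexI[of _ "((- e s * i) mod (8 * k), s)"])
       (auto simp: x mult mod_simps SD_simps(1,3))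
  fix y assume "y \<in> carrier (SD k)"
  then obtain j t where y: "y = (j, t)"
    by (cases y) auto
  show "x \<otimes>\<^bsub>SD k\<^esub> y \<in> carrier (SD k)"
    using assms by (simp add: x y SD_simps)
  fix z assume "z \<in> carrier (SD k)"
  obtain l u where z: "z = (l, u)"
    by (cases z) auto
  have "(i + e s * j + e (s \<noteq> t) * l) mod (8 * k) = (i + e s * j + e s * (e t * l)) mod (8 * k)"
    using e[of s t l] by (metis mod_add_right_eq)
  also have "\<dots> = (i + e s * (j + e t * l)) mod (8 * k)"
    by (simp add: algebra_simps)
  also have "\<dots> = (i + e s * ((j + e t * l) mod (8 * k))) mod (8 * k)"
    by (metis mod_add_right_eq mod_mult_right_eq)
  finally show "x \<otimes>\<^bsub>SD k\<^esub> y \<otimes>\<^bsub>SD k\<^esub> z = x \<otimes>\<^bsub>SD k\<^esub> (y \<otimes>\<^bsub>SD k\<^esub> z)"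
    by (auto simp: x y z mult mod_simps)
qed (use assms in \<open>simp add: SD_simps\<close>)

section \<open>Identifying the presented group with the model\<close>

text \<open>The relations move \<open>b\<close> to the right past powers of \<open>a\<close>, and
  \<open>inv a\<close>, \<open>inv b\<close> are themselves \<open>a [^] (M - 1)\<close> and
  \<open>b\<close>. Applied letter by letter, this brings every word into normal form.\<close>

lemma (in group) semidihedral_normal_form:
  fixes M c :: nat
  assumes ab: "a \<in> carrier G" "b \<in> carrier G" and M: "M > 0" "a [^] M = \<one>" and b: "b \<otimes> b = \<one>"
    and ba: "b \<otimes> a \<otimes> inv b = a [^] c"
    and x: "x \<in> {a, inv a, b, inv b}" and y: "y \<in> {a [^] i \<otimes> d | i d. i < M \<and> d \<in> {\<one>, b}}"
  shows "x \<otimes> y \<in> {a [^] i \<otimes> d | i d. i < M \<and> d \<in> {\<one>, b}}" (is "_ \<in> ?S")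
proof -
  have red: "a [^] i \<otimes> d \<in> ?S" if "d \<in> {\<one>, b}" for i :: nat and d
  proof -
    have "a [^] i = a [^] (M * (i div M) + i mod M)"
      by simp
    also have "\<dots> = (a [^] M) [^] (i div M) \<otimes> a [^] (i mod M)"
      using ab by (simp add: nat_pow_mult nat_pow_pow)
    finally have "a [^] i = a [^] (i mod M)"
      using ab M by simp
    then show ?thesis
      using M(1) that by fastforce
  qed
  have inv_b: "inv b = b"
    using b ab by (simp add: inv_equality)
  have inv_a: "inv a = a [^] (M - 1)"
  proof (rule inv_equality)
    have "a [^] (M - 1) \<otimes> a = a [^] Suc (M - 1)"
      by simp
    then show "a [^] (M - 1) \<otimes> a = \<one>"
      using M by simp
  qed (use ab in auto)
  have ba': "b \<otimes> a = a [^] c \<otimes> b"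
    using ba ab by (metis inv_solve_right nat_pow_closed m_closed)
  have b_pow: "b \<otimes> a [^] i = a [^] (c * i) \<otimes> b" for i :: nat
  proof (induction i)
    case (Suc i)
    have "b \<otimes> a [^] Suc i = (b \<otimes> a [^] i) \<otimes> a"
      using ab by (simp add: m_assoc)
    also have "\<dots> = a [^] (c * i) \<otimes> (b \<otimes> a)"
      using ab by (simp add: Suc m_assoc)
    also have "\<dots> = a [^] (c * i) \<otimes> a [^] c \<otimes> b"
      using ab by (simp add: ba' m_assoc)
    also have "a [^] (c * i) \<otimes> a [^] c = a [^] (c * Suc i)"
      using ab by (simp add: nat_pow_mult add.commute)
    finally show ?case .
  qed (use ab in simp)
  obtain i :: nat and d where y: "y = a [^] i \<otimes> d" "d \<in> {\<one>, b}"
    using y by blast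
  have d: "d \<in> carrier G"
    using y ab by auto
  have a_pow: "a [^] j \<otimes> y \<in> ?S" for j :: nat
  proof -
    have "a [^] j \<otimes> y = a [^] (j + i) \<otimes> d"
      using ab d by (simp add: y m_assoc flip: nat_pow_mult)
    then show ?thesis
      using red[OF y(2)] by simp
  qed
  have "b \<otimes> y \<in> ?S"
  proof -
    have "b \<otimes> y = a [^] (c * i) \<otimes> (b \<otimes> d)"
      using ab d by (simp add: y b_pow m_assoc flip: m_assoc[of b])
    moreover have "b \<otimes> d \<in> {\<one>, b}"
      using y(2) ab b by auto
    ultimately show ?thesis
      using red by simp
  qed
  then show ?thesis
    using x a_pow[of 1] a_pow[of "M - 1"] ab by (auto simp: inv_b inv_a)
qed

lemma two_power_shift:
  assumes "n \<ge> 4"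
  shows "2 ^ (n - 1) = 8 * (2 :: 'a :: semiring_1) ^ (n - 4)"
    and "2 ^ (n - 2) = 4 * (2 :: 'a) ^ (n - 4)"
    and "2 ^ n = 16 * (2 :: 'a) ^ (n - 4)"
proof -
  have "n = Suc (Suc (Suc (Suc (n - 4))))"
    using assms by simp
  then obtain m where "n = Suc (Suc (Suc (Suc m)))"
    by blast
  then show "2 ^ (n - 1) = 8 * (2 :: 'a) ^ (n - 4)" "2 ^ (n - 2) = 4 * (2 :: 'a) ^ (n - 4)"
    "2 ^ n = 16 * (2 :: 'a) ^ (n - 4)"
    by simp_all
qed

text \<open>The universal property gives a homomorphism \<open>\<phi>\<close> to the model; the
  normal form shows that \<open>\<psi>\<close> from the model hits every element. Since
  \<open>\<phi>\<close> undoes \<open>\<psi>\<close>, both are bijective, and the order of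
  \<open>a\<close> need not be known beforehand.\<close>

lemma QD_iso_SD:
  assumes n: "n \<ge> 4"
  shows "\<exists>\<phi>. \<phi> \<in> iso (QD n) (SD (2 ^ (n - 4)))"
proof -
  define k :: nat where "k = 2 ^ (n - 4)"
  have k: "k > 0"
    by (simp add: k_def)
  have pow: "2 ^ (n - 1) = 8 * k" "2 ^ (n - 2) = 4 * k"
    by (simp_all only: k_def two_power_shift[OF n])
  define R where "R = {(replicate (8 * k) (Gen GenA), []), ([Gen GenB, Gen GenB], []),
     ([Gen GenB, Gen GenA, Inv GenB], replicate (4 * k - 1) (Gen GenA))}"
  have QD: "QD n = presented_group R"
    by (simp only: QD_def R_def pow)
  let ?G = "presented_group R" and ?H = "SD (int k)"
  interpret G: group ?G
    by (rule group_presented_group)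
  interpret H: group ?H
    by (rule group_SD) (use k in simp)
  have car: "carrier ?G = range (word_class R)" and one: "\<one>\<^bsub>?G\<^esub> = word_class R []"
    by (simp_all add: presented_group_def)
  define f where "f g = (case g of GenA \<Rightarrow> (1 :: int, False) | GenB \<Rightarrow> (0, True))" for g
  have f_car: "f g \<in> carrier ?H" for g
    using k by (auto simp: f_def SD_simps split: qd_gen.split)
  have val_A: "word_val ?H f (replicate r (Gen GenA)) = (int r mod (8 * int k), False)" for r
    by (induction r) (auto simp: SD_simps f_def mod_simps)
  have inv_B: "inv\<^bsub>?H\<^esub> f GenB = f GenB"
    using f_car[of GenB] by (intro H.inv_equality) (auto simp: SD_simps f_def)
  have rels: "word_val ?H f u = word_val ?H f v" if uv: "(u, v) \<in> R" for u v
  proof -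
    consider "u = replicate (8 * k) (Gen GenA)" "v = []" | "u = [Gen GenB, Gen GenB]" "v = []"
      | "u = [Gen GenB, Gen GenA, Inv GenB]" "v = replicate (4 * k - 1) (Gen GenA)"
      using uv unfolding R_def by blast
    then show ?thesis
    proof cases
      case 1
      then show ?thesis
        by (simp add: val_A SD_simps)
    next
      case 2
      then show ?thesis
        by (simp add: f_def SD_simps)
    next
      case 3
      then show ?thesis
        using k by (simp add: val_A inv_B) (simp add: f_def SD_simps of_nat_diff)
    qed
  qed
  obtain \<phi> where \<phi>: "\<phi> \<in> hom ?G ?H" "\<phi> (word_class R [Gen g]) = f g" for g
    using presented_group_universal[OF H.is_group, of f R, OF f_car rels] by blast
  interpret \<phi>: group_hom ?G ?H \<phi>
    by unfold_locales (rule \<phi>(1))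
  define a b where "a = word_class R [Gen GenA]" and "b = word_class R [Gen GenB]"
  have ab: "a \<in> carrier ?G" "b \<in> carrier ?G"
    by (auto simp: a_def b_def car)
  have cons: "word_class R (x # w) = word_class R [x] \<otimes>\<^bsub>?G\<^esub> word_class R w" for x w
    by (simp add: mult_word_class)
  have flip: "word_class R [Inv g] = inv\<^bsub>?G\<^esub> word_class R [Gen g]" for g
  proof -
    have "word_class R [Inv g] \<otimes>\<^bsub>?G\<^esub> word_class R [Gen g] = \<one>\<^bsub>?G\<^esub>"
      using word_eq.cancel[of R "Inv g"] by (simp add: mult_word_class one word_class_eq_iff)
    then show ?thesis
      by (intro G.inv_equality[symmetric]) (auto simp: car)
  qed
  have pow_a: "word_class R (replicate r (Gen GenA)) = a [^]\<^bsub>?G\<^esub> r" for r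
  proof (induction r)
    case (Suc r)
    have "word_class R (replicate (Suc r) (Gen GenA)) = a \<otimes>\<^bsub>?G\<^esub> a [^]\<^bsub>?G\<^esub> r"
      using cons[of "Gen GenA" "replicate r (Gen GenA)"] by (simp add: Suc a_def)
    then show ?case
      using G.nat_pow_Suc2[OF ab(1)] by simp
  qed (simp add: one)
  have ab_rels: "a [^]\<^bsub>?G\<^esub> (8 * k) = \<one>\<^bsub>?G\<^esub>" "b \<otimes>\<^bsub>?G\<^esub> b = \<one>\<^bsub>?G\<^esub>"
    "b \<otimes>\<^bsub>?G\<^esub> a \<otimes>\<^bsub>?G\<^esub> inv\<^bsub>?G\<^esub> b = a [^]\<^bsub>?G\<^esub> (4 * k - 1)"
  proof -
    have wc: "word_class R u = word_class R v" if "(u, v) \<in> R" for u v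
      using that by (simp add: word_class_eq_iff word_eq.rel)
    show "a [^]\<^bsub>?G\<^esub> (8 * k) = \<one>\<^bsub>?G\<^esub>"
      unfolding pow_a[symmetric] one by (rule wc) (simp add: R_def)
    show "b \<otimes>\<^bsub>?G\<^esub> b = \<one>\<^bsub>?G\<^esub>"
      unfolding b_def mult_word_class one by (rule wc) (simp add: R_def)
    show "b \<otimes>\<^bsub>?G\<^esub> a \<otimes>\<^bsub>?G\<^esub> inv\<^bsub>?G\<^esub> b = a [^]\<^bsub>?G\<^esub> (4 * k - 1)"
      unfolding pow_a[symmetric] unfolding a_def b_def flip[symmetric] mult_word_class
      by (rule wc) (simp add: R_def)
  qed
  define S where "S = {a [^]\<^bsub>?G\<^esub> i \<otimes>\<^bsub>?G\<^esub> d | i d. i < 8 * k \<and> d \<in> {\<one>\<^bsub>?G\<^esub>, b}}"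
  have "word_class R w \<in> S" for w
  proof (induction w)
    case Nil
    have "\<one>\<^bsub>?G\<^esub> = a [^]\<^bsub>?G\<^esub> (0 :: nat) \<otimes>\<^bsub>?G\<^esub> \<one>\<^bsub>?G\<^esub>"
      by simp
    then show ?case
      using k unfolding S_def one[symmetric] by fastforce
  next
    case (Cons x w)
    have "word_class R [x] \<in> {a, inv\<^bsub>?G\<^esub> a, b, inv\<^bsub>?G\<^esub> b}"
    proof (cases x)
      case (Gen g)
      then show ?thesis
        by (cases g) (auto simp: a_def b_def)
    next
      case (Inv g)
      then show ?thesis
        by (cases g) (auto simp: flip a_def b_def)
    qed
    then show ?case
      unfolding cons[of x w] S_def
      using G.semidihedral_normal_form[OF ab _ ab_rels] Cons k by (simp add: S_def)
  qed
  then have X_in_S: "X \<in> S" if "X \<in> carrier ?G" for X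
    using that by (auto simp: car)
  define \<psi> where "\<psi> = (\<lambda>(i, s). a [^]\<^bsub>?G\<^esub> nat i \<otimes>\<^bsub>?G\<^esub> (if s then b else \<one>\<^bsub>?G\<^esub>))"
  have \<psi>: "\<exists>u\<in>carrier ?H. X = \<psi> u" if X: "X \<in> carrier ?G" for X
  proof -
    obtain i :: nat and d where "X = a [^]\<^bsub>?G\<^esub> i \<otimes>\<^bsub>?G\<^esub> d" "i < 8 * k" "d \<in> {\<one>\<^bsub>?G\<^esub>, b}"
      using X_in_S[OF X] unfolding S_def by blast
    \<comment> \<open>Testing \<open>d\<close> against the identity gives a valid flag even though
      \<open>b\<close> has not been shown to be nontrivial.\<close>
    then show ?thesis
      by (intro bexI[of _ "(int i, d \<noteq> \<one>\<^bsub>?G\<^esub>)"]) (auto simp: \<psi>_def SD_simps)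
  qed
  have \<phi>_pow: "\<phi> (a [^]\<^bsub>?G\<^esub> r) = (int r mod (8 * int k), False)" for r :: nat
  proof (induction r)
    case (Suc r)
    then show ?case
      using ab by (simp add: a_def \<phi>(2) f_def SD_simps mod_simps add.commute)
  qed (simp add: SD_simps)
  have \<phi>\<psi>: "\<psi> u \<in> carrier ?G" "\<phi> (\<psi> u) = u" if u_car: "u \<in> carrier ?H" for u
  proof -
    obtain i s where "u = (i, s)" "0 \<le> i" "i < 8 * int k"
      using u_car by (cases u) (auto simp: SD_simps)
    then obtain r where u: "u = (int r, s)" "r < 8 * k"
      by (auto elim: nonneg_int_cases)
    show "\<psi> u \<in> carrier ?G"
      using ab by (simp add: \<psi>_def u)
    have "\<phi> (\<psi> u) = (int r, False) \<otimes>\<^bsub>?H\<^esub> \<phi> (if s then b else \<one>\<^bsub>?G\<^esub>)"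
      using ab u by (simp add: \<psi>_def \<phi>_pow)
    also have "\<dots> = u"
      using u by (auto simp: b_def \<phi>(2) f_def SD_simps)
    finally show "\<phi> (\<psi> u) = u" .
  qed
  have "bij_betw \<phi> (carrier ?G) (carrier ?H)"
    by (rule bij_betw_byWitness[where f' = \<psi>]) (use \<psi> \<phi>\<psi> in fastforce)+
  then show ?thesis
    using \<phi>(1) by (auto simp: QD iso_def k_def)
qed

section \<open>Commutation and centre in the model\<close>

text \<open>\<open>4k - 2 = 2(2k - 1)\<close>, and \<open>2k - 1\<close> is a unit modulo
  \<open>4k\<close>. In the model, the exponents of \<open>xy\<close> and \<open>yx\<close> differ
  by a multiple of \<open>4k - 2\<close>.\<close>

lemma dvd_SD_commutator:
  fixes k x :: int
  shows "8 * k dvd (4 * k - 2) * x \<longleftrightarrow> 4 * k dvd x"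
proof -
  have "coprime (4 * k) (2 * k - 1)"
  proof -
    have "coprime (2 * k) (2 * k - 1)"
      using coprime_diff_one_left[of "2 * k"] by (simp only: coprime_commute)
    then have "coprime (2 * (2 * k)) (2 * k - 1)"
      by (simp only: coprime_mult_left_iff simp_thms)
    then show ?thesis
      by simp
  qed
  then have "4 * k dvd (2 * k - 1) * x \<longleftrightarrow> 4 * k dvd x"
    by (simp add: coprime_dvd_mult_right_iff)
  moreover have "8 * k dvd (4 * k - 2) * x \<longleftrightarrow> 2 * (4 * k) dvd 2 * ((2 * k - 1) * x)"
    by (simp add: algebra_simps)
  ultimately show ?thesis
    by (simp only: dvd_mult_cancel_left) simp
qed

lemma SD_commute_iff:
  "(i, False) \<otimes>\<^bsub>SD k\<^esub> (j, False) = (j, False) \<otimes>\<^bsub>SD k\<^esub> (i, False)"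
  "(i, False) \<otimes>\<^bsub>SD k\<^esub> (j, True) = (j, True) \<otimes>\<^bsub>SD k\<^esub> (i, False) \<longleftrightarrow> 4 * k dvd i"
  "(i, True) \<otimes>\<^bsub>SD k\<^esub> (j, True) = (j, True) \<otimes>\<^bsub>SD k\<^esub> (i, True) \<longleftrightarrow> 4 * k dvd i - j"
  "(j, True) \<otimes>\<^bsub>SD k\<^esub> (i, False) = (i, False) \<otimes>\<^bsub>SD k\<^esub> (j, True) \<longleftrightarrow> 4 * k dvd i"
proof -
  show "(i, True) \<otimes>\<^bsub>SD k\<^esub> (j, True) = (j, True) \<otimes>\<^bsub>SD k\<^esub> (i, True) \<longleftrightarrow> 4 * k dvd i - j"
    using dvd_SD_commutator[of k "j - i"]
    by (simp add: SD_simps mod_eq_dvd_iff algebra_simps dvd_diff_commute)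
qed (use dvd_SD_commutator[of k i] dvd_diff_commute[of "8 * k"] in
      \<open>simp_all add: SD_simps mod_eq_dvd_iff algebra_simps\<close>)

text \<open>Two test elements suffice: \<open>a\<close> commutes with no \<open>a^i b\<close>, and
  \<open>b\<close> commutes with \<open>a^i\<close> only if \<open>4k\<close> divides
  \<open>i\<close>.\<close>

lemma group_center_SD:
  assumes "k > 0"
  shows "group_center (SD k) = {(i, False) | i. 0 \<le> i \<and> i < 8 * k \<and> 4 * k dvd i}" (is "_ = ?Z")
proof (intro subset_antisym subsetI)
  fix x assume x: "x \<in> group_center (SD k)"
  obtain i s where xis: "x = (i, s)"
    by (cases x)
  have i: "0 \<le> i" "i < 8 * k" and comm: "x \<otimes>\<^bsub>SD k\<^esub> y = y \<otimes>\<^bsub>SD k\<^esub> x" if "y \<in> carrier (SD k)" for y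
    using x that by (auto simp: group_center_def SD_simps(1) xis)
  have "(0, True) \<in> carrier (SD k)" "(1, False) \<in> carrier (SD k)"
    using assms by (auto simp: SD_simps)
  moreover have "\<not> 4 * k dvd 1"
    using assms by (auto dest: zdvd_imp_le)
  ultimately have "\<not> s" "4 * k dvd i"
    using comm[of "(0, True)"] comm[of "(1, False)"] by (cases s; simp add: xis SD_commute_iff)+
  then show "x \<in> ?Z"
    using i \<open>(0, True) \<in> carrier (SD k)\<close> by (simp add: xis)
next
  fix x assume "x \<in> ?Z"
  then obtain i where x: "x = (i, False)" "0 \<le> i" "i < 8 * k" "4 * k dvd i"
    by blast
  moreover have "x \<otimes>\<^bsub>SD k\<^esub> (j, t) = (j, t) \<otimes>\<^bsub>SD k\<^esub> x" for j t
    using x by (cases t) (simp_all add: SD_commute_iff)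
  ultimately show "x \<in> group_center (SD k)"
    by (auto simp: group_center_def SD_simps(1))
qed

section \<open>The spectrum for the model\<close>

text \<open>There are \<open>16k - 2\<close> vertices, in one part of size \<open>8k - 2\<close> and
  \<open>4k\<close> parts of size 2. Removing a representative of each leaves \<open>8k - 3\<close>
  and \<open>4k\<close> vertices, with eigenvalues \<open>8k\<close> and
  \<open>16k - 4\<close>.\<close>

lemma laplacian_spectrum_SD:
  fixes k :: nat
  assumes k: "k > 0"
  shows "laplacian_spectrum (noncommuting_graph (SD (int k))) =
    {#0#} + replicate_mset (8 * k - 3) (8 * real k) + replicate_mset (4 * k) (16 * real k - 4)
          + replicate_mset (4 * k) (16 * real k - 2)"
proof -
  let ?G = "noncommuting_graph (SD (int k))"
  have dvd: "4 * int k dvd i \<longleftrightarrow> i = 0 \<or> i = 4 * int k" if "0 \<le> i" "i < 8 * int k" for i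
  proof
    assume "4 * int k dvd i"
    then obtain q where q: "i = 4 * int k * q" ..
    have "0 \<le> q"
      using that k by (simp add: q zero_le_mult_iff)
    moreover have "4 * int k * q < 4 * int k * 2"
      using that(2)[unfolded q] by linarith
    then have "q < 2"
      by (rule mult_less_cancel_left_pos[THEN iffD1, rotated]) (use k in simp)
    ultimately have "q = 0 \<or> q = 1"
      by auto
    then show "i = 0 \<or> i = 4 * int k"
      by (auto simp: q)
  qed auto
  define A where "A = {0..<8 * int k} - {0, 4 * int k}"
  define V where "V = A \<times> {False} \<union> {0..<8 * int k} \<times> {True}"
  have V: "pverts ?G = V"
    using k dvd by (auto simp: noncommuting_graph_def group_center_SD SD_simps(1) V_def A_def)
  \<comment> \<open>The label -1 for powers of \<open>a\<close> is never a residue modulo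
    \<open>4k\<close>, so it cannot clash with a label of some \<open>a^i b\<close>.\<close>
  define p where "p = (\<lambda>(i, s). if s then i mod (4 * int k) else - 1)"
  define R where "R = insert (1, False) ({0..<4 * int k} \<times> {True})"
  have mod: "i mod (4 * int k) \<noteq> - 1" "- 1 \<noteq> i mod (4 * int k)" for i
    using pos_mod_sign[of "4 * int k" i] k by linarith+
  have "x \<otimes>\<^bsub>SD (int k)\<^esub> y = y \<otimes>\<^bsub>SD (int k)\<^esub> x \<longleftrightarrow> p x = p y" if "x \<in> V" "y \<in> V" for x y
    using that dvd mod
    by (auto simp: V_def A_def p_def SD_commute_iff mod_eq_dvd_iff)
  then have arcs: "parcs ?G = {(x, y). x \<in> pverts ?G \<and> y \<in> pverts ?G \<and> p x \<noteq> p y}"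
    using V by (auto simp: noncommuting_graph_def)
  have A1: "1 \<in> A" "A \<subseteq> {0..<8 * int k}"
    using k by (auto simp: A_def)
  have "p ` V \<subseteq> p ` R"
  proof
    fix z assume "z \<in> p ` V"
    then obtain i s where "z = p (i, s)"
      by auto
    then have "z = p (if s then (i mod (4 * int k), True) else (1, False))"
      by (simp add: p_def)
    moreover have "(if s then (i mod (4 * int k), True) else (1, False)) \<in> R"
      using k by (simp add: R_def)
    ultimately show "z \<in> p ` R"
      by blast
  qed
  moreover have "R \<subseteq> V"
    using A1 by (auto simp: R_def V_def)
  moreover have "inj_on p R"
    using mod by (auto simp: inj_on_def R_def p_def)
  moreover have "finite V"
    by (simp add: V_def A_def)
  ultimately have *: "laplacian_spectrum ?G = {#0#} + replicate_mset (card R - 1) (real (card V)) +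
      {#real (card V) - real (card {y \<in> V. p y = p x}). x \<in># mset_set (V - R)#}"
    using laplacian_spectrum_multipartite[OF _ arcs, of R] by (simp add: V R_def)
  have card_A: "card A = 8 * k - 2"
    using k by (simp add: A_def card_Diff_subset)
  have card_V: "real (card V) = 16 * real k - 2"
    using k by (simp add: V_def card_Un_disjoint disjoint_iff card_A A_def[symmetric]
        card_cartesian_product of_nat_diff finite_subset[OF A1(2)])
  have card_R: "card R = Suc (4 * k)"
    by (simp add: R_def card_cartesian_product)
  have const: "image_mset f (mset_set X) = replicate_mset (card X) c"
    if "\<And>x. x \<in> X \<Longrightarrow> f x = c" "finite X" for f :: "int \<times> bool \<Rightarrow> real" and X c
  proof -
    have "image_mset f (mset_set X) = image_mset (\<lambda>_. c) (mset_set X)"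
      using that by (intro image_mset_cong) simp
    then show ?thesis
      by (simp add: image_mset_const_eq)
  qed
  have "{y \<in> V. p y = p (i, False)} = A \<times> {False}" for i
    using mod by (auto simp: V_def p_def)
  then have fibre_F: "card {y \<in> V. p y = p (i, False)} = 8 * k - 2" for i
    by (simp add: card_cartesian_product card_A)
  \<comment> \<open>Only the upper half is left outside \<open>R\<close>; the other member of the
    part of \<open>a^i b\<close> is then \<open>a^(i - 4k) b\<close>.\<close>
  have fibre_T: "card {y \<in> V. p y = p (i, True)} = 2" if i: "4 * int k \<le> i" "i < 8 * int k" for i
  proof -
    have "j mod (4 * int k) = i mod (4 * int k) \<longleftrightarrow> j = i \<or> j = i - 4 * int k"
      if j: "0 \<le> j" "j < 8 * int k" for j
    proof -
      have "j mod (4 * int k) = i mod (4 * int k) \<longleftrightarrow> 4 * int k dvd i - j"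
        by (metis mod_eq_dvd_iff)
      also have "\<dots> \<longleftrightarrow> i - j = 0 \<or> i - j = 4 * int k"
      proof (cases "j \<le> i")
        case True
        then show ?thesis
          using dvd[of "i - j"] i j by simp
      next
        \<comment> \<open>Now \<open>i - j\<close> lies strictly between \<open>-4k\<close> and 0;
          adding \<open>4k\<close> brings it into the range of \<open>dvd\<close>, strictly between
          0 and \<open>4k\<close>.\<close>
        case False
        then show ?thesis
          using dvd[of "i - j + 4 * int k"] i j by simp
      qed
      also have "\<dots> \<longleftrightarrow> j = i \<or> j = i - 4 * int k"
        by auto
      finally show ?thesis .
    qed
    then have "{y \<in> V. p y = p (i, True)} = {(i, True), (i - 4 * int k, True)}"
      using mod i by (auto simp: V_def p_def)
    then show ?thesis
      using k by simp
  qed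
  let ?f = "\<lambda>x. real (card V) - real (card {y \<in> V. p y = p x})"
  have VR: "V - R = (A - {1}) \<times> {False} \<union> {4 * int k..<8 * int k} \<times> {True}"
    using A1 by (auto simp: V_def R_def)
  have finA: "finite A"
    by (simp add: A_def)
  have "image_mset ?f (mset_set (V - R)) =
      image_mset ?f (mset_set ((A - {1}) \<times> {False})) + image_mset ?f (mset_set ({4 * int k..<8 * int k} \<times> {True}))"
    unfolding VR using finA by (subst mset_set_Union) auto
  also have "image_mset ?f (mset_set ((A - {1}) \<times> {False})) = replicate_mset (8 * k - 3) (8 * real k)"
    using k finA by (subst const[where c = "8 * real k"])
      (auto simp: fibre_F card_V of_nat_diff card_cartesian_product card_A A1)
  also have "image_mset ?f (mset_set ({4 * int k..<8 * int k} \<times> {True})) =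
      replicate_mset (4 * k) (16 * real k - 4)"
    by (subst const[where c = "16 * real k - 4"])
      (auto simp: fibre_T card_V card_cartesian_product nat_mult_distrib)
  finally show ?thesis
    unfolding * by (simp add: card_R card_V)
qed

theorem proposition4p2:
  fixes n :: nat
  assumes "n \<ge> 4"
  shows "laplacian_spectrum (noncommuting_graph (QD n)) =
    {#0#} + replicate_mset (2 ^ (n - 1) - 3) (2 ^ (n - 1))
          + replicate_mset (2 ^ (n - 2)) (2 ^ n - 4)
          + replicate_mset (2 ^ (n - 2)) (2 ^ n - 2)"
proof -
  define k :: nat where "k = 2 ^ (n - 4)"
  obtain \<phi> where \<phi>: "\<phi> \<in> iso (QD n) (SD (int k))"
    using QD_iso_SD[OF assms] by (auto simp: k_def)
  \<comment> \<open>Finiteness of the presented group is read off from the model.\<close>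
  have "finite (carrier (QD n))"
    using \<phi> bij_betw_finite[of \<phi>] by (auto simp: iso_def SD_simps)
  moreover have "monoid (QD n)"
    unfolding QD_def by (intro group.is_monoid group_presented_group)
  ultimately have "laplacian_spectrum (noncommuting_graph (QD n)) =
      laplacian_spectrum (noncommuting_graph (SD (int k)))"
    using laplacian_spectrum_noncommuting_graph_iso[OF \<phi>] by blast
  also have "\<dots> = {#0#} + replicate_mset (8 * k - 3) (8 * real k)
      + replicate_mset (4 * k) (16 * real k - 4) + replicate_mset (4 * k) (16 * real k - 2)"
    by (rule laplacian_spectrum_SD) (simp add: k_def)
  finally show ?thesis
    by (simp only: k_def two_power_shift[OF assms] of_nat_power of_nat_numeral)
qed

end
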